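(* Let $\mathcal{A}=\{a_1,\ldots,a_n\}\subset\mathbb{Z}^d$ and let $w=(w_1,\ldots,w_n)\in\mathbb{N}^n$. Assume that there exists an element $a\in\mathbb{N}\mathcal{A}$ such that $a+\overline{\mathbb{N}\mathcal{A}}\subset\mathbb{N}\mathcal{A}$. Then there exists $\delta\in\mathbb{N}$ such that $(a,\delta)\in\mathbb{N}\mathcal{A}_w$ and $(a,\delta)+\overline{\mathbb{N}\mathcal{A}_w}\subset\mathbb{N}\mathcal{A}_w$.
   Context: $\mathbb{N}$ contains $0$. For a finite set $\mathcal{B}\subset\mathbb{Z}^k$, $\mathbb{N}\mathcal{B}$ denotes the submonoid of $\mathbb{Z}^k$ consisting of all $\mathbb{N}$-linear combinations of elements of $\mathcal{B}$, and $\overline{\mathbb{N}\mathcal{B}}:=\mathbb{R}_{\geq0}\mathcal{B}\cap\mathbb{Z}^k$ is its saturation, where $\mathbb{R}_{\ge0}\mathcal{B}$ is the cone of all $\mathbb{R}_{\geq 0}$-linear combinations of elements of $\mathcal{B}$. Moreover $\mathcal{A}_w:=\{(a_1,w_1),\ldots,(a_n,w_n),(0,\ldots,0,1)\}\subset\mathbb{Z}^{d+1}$. *)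

theory Defs
  imports Complex_Main "Jordan_Normal_Form.Matrix"
begin

text \<open>
  Elements of \<open>\<int>\<^sup>k\<close> are the vectors in \<^term>\<open>carrier_vec k :: int vec set\<close>, so that
  \<open>\<int>\<^sup>d\<close> and \<open>\<int>\<^sup>d\<^sup>+\<^sup>1\<close> can be treated by the same definitions.  The definitions
  below are meant for finite sets \<open>B \<subseteq> carrier_vec k\<close>.
\<close>

definition nat_span :: "nat \<Rightarrow> int vec set \<Rightarrow> int vec set" where
  "nat_span k B =
     {finsum_vec TYPE(int) k (\<lambda>b. int (c b) \<cdot>\<^sub>v b) B | c :: int vec \<Rightarrow> nat. True}"

definition real_cone :: "nat \<Rightarrow> int vec set \<Rightarrow> real vec set" where
  "real_cone k B =
     {finsum_vec TYPE(real) k (\<lambda>b. c b \<cdot>\<^sub>v map_vec real_of_int b) B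
        | c :: int vec \<Rightarrow> real. \<forall>b\<in>B. c b \<ge> 0}"

definition saturation :: "nat \<Rightarrow> int vec set \<Rightarrow> int vec set" where
  "saturation k B = {x \<in> carrier_vec k. map_vec real_of_int x \<in> real_cone k B}"

definition snoc_vec :: "'a vec \<Rightarrow> 'a \<Rightarrow> 'a vec" where
  "snoc_vec v z = v @\<^sub>v vec 1 (\<lambda>_. z)"

definition lifted_set :: "nat \<Rightarrow> nat \<Rightarrow> (nat \<Rightarrow> int vec) \<Rightarrow> (nat \<Rightarrow> nat) \<Rightarrow> int vec set" where
  "lifted_set d n p w =
     {snoc_vec (p i) (int (w i)) | i. i \<in> {1..n}} \<union> {snoc_vec (0\<^sub>v d) 1}"

end

theory Submission
  imports Defs "HOL-Library.FuncSet"
begin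

text \<open>
  Rounding down the coefficients of a cone combination writes every element of
  \<open>saturation k B\<close> as \<open>f + y\<close> with \<open>y\<close> in the monoid \<open>nat_span k B\<close> and \<open>f\<close> in a finite
  subset \<open>F\<close> of the saturation.  Apply this to the lifted set.  For \<open>f \<in> F\<close> with projection
  \<open>r\<close> to the first \<open>d\<close> coordinates, \<open>r\<close> lies in \<open>saturation d A\<close>, so \<open>a + r\<close> is in the
  monoid of \<open>A\<close> and lifts to some element of the lifted monoid; since \<open>(0, 1)\<close> is a generator,
  \<open>(a, \<delta>) + f\<close> is in the lifted monoid for every large \<open>\<delta>\<close>.  As \<open>F\<close> is finite, one \<open>\<delta>\<close>
  serves all of \<open>F\<close>, and hence the whole saturation.
\<close>

section \<open>Coordinatewise descriptions of the monoid and of its saturation\<close>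

lemma nat_span_iff:
  assumes "finite B" "B \<subseteq> carrier_vec k"
  shows "x \<in> nat_span k B \<longleftrightarrow>
    x \<in> carrier_vec k \<and> (\<exists>c. \<forall>i<k. x $ i = (\<Sum>b\<in>B. int (c b) * b $ i))"
proof -
  have closed: "finsum_vec TYPE(int) k (\<lambda>b. int (c b) \<cdot>\<^sub>v b) B \<in> carrier_vec k"
    for c :: "int vec \<Rightarrow> nat"
    using assms by (intro finsum_vec_closed) auto
  have index: "finsum_vec TYPE(int) k (\<lambda>b. int (c b) \<cdot>\<^sub>v b) B $ i = (\<Sum>b\<in>B. int (c b) * b $ i)"
    if "i < k" for i and c :: "int vec \<Rightarrow> nat"
    using assms that by (subst index_finsum_vec) (auto intro!: sum.cong)
  have "x = finsum_vec TYPE(int) k (\<lambda>b. int (c b) \<cdot>\<^sub>v b) B \<longleftrightarrow>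
    x \<in> carrier_vec k \<and> (\<forall>i<k. x $ i = (\<Sum>b\<in>B. int (c b) * b $ i))" for c
    using closed[of c] index[of _ c] by (auto simp: vec_eq_iff)
  then show ?thesis
    unfolding nat_span_def by auto
qed

lemma saturation_iff:
  assumes "finite B" "B \<subseteq> carrier_vec k"
  shows "x \<in> saturation k B \<longleftrightarrow>
    x \<in> carrier_vec k \<and>
    (\<exists>c. (\<forall>b\<in>B. c b \<ge> 0) \<and> (\<forall>i<k. real_of_int (x $ i) = (\<Sum>b\<in>B. c b * real_of_int (b $ i))))"
proof -
  have closed: "finsum_vec TYPE(real) k (\<lambda>b. c b \<cdot>\<^sub>v map_vec real_of_int b) B \<in> carrier_vec k"
    for c :: "int vec \<Rightarrow> real"
    using assms by (intro finsum_vec_closed) auto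
  have index: "finsum_vec TYPE(real) k (\<lambda>b. c b \<cdot>\<^sub>v map_vec real_of_int b) B $ i =
      (\<Sum>b\<in>B. c b * real_of_int (b $ i))"
    if "i < k" for i and c :: "int vec \<Rightarrow> real"
    using assms that by (subst index_finsum_vec) (auto intro!: sum.cong)
  have "map_vec real_of_int x = finsum_vec TYPE(real) k (\<lambda>b. c b \<cdot>\<^sub>v map_vec real_of_int b) B \<longleftrightarrow>
    (\<forall>i<k. real_of_int (x $ i) = (\<Sum>b\<in>B. c b * real_of_int (b $ i)))"
    if "x \<in> carrier_vec k" for c
    using closed[of c] index[of _ c] that by (auto simp: vec_eq_iff)
  then show ?thesis
    unfolding saturation_def real_cone_def by auto
qed

lemma nat_span_add:
  assumes "finite B" "B \<subseteq> carrier_vec k" "x \<in> nat_span k B" "y \<in> nat_span k B"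
  shows "x + y \<in> nat_span k B"
proof -
  from assms obtain c e where "x \<in> carrier_vec k" "y \<in> carrier_vec k"
    and "\<forall>i<k. x $ i = (\<Sum>b\<in>B. int (c b) * b $ i)"
    and "\<forall>i<k. y $ i = (\<Sum>b\<in>B. int (e b) * b $ i)"
    by (auto simp: nat_span_iff)
  then have "\<forall>i<k. (x + y) $ i = (\<Sum>b\<in>B. int (c b + e b) * b $ i)"
    by (auto simp: sum.distrib algebra_simps)
  then show ?thesis
    using assms \<open>x \<in> carrier_vec k\<close> \<open>y \<in> carrier_vec k\<close>
    by (auto simp: nat_span_iff intro!: exI[of _ "\<lambda>b. c b + e b"])
qed

text \<open>Used with the generator \<open>(0, 1)\<close>, whose multiples raise the last coordinate
  and leave the first \<open>d\<close> coordinates alone.\<close>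

lemma nat_span_add_multiple:
  assumes "finite B" "B \<subseteq> carrier_vec k" "x \<in> nat_span k B" "g \<in> B"
  shows "x + int m \<cdot>\<^sub>v g \<in> nat_span k B"
proof -
  have "int m \<cdot>\<^sub>v g \<in> nat_span k B"
    using assms by (auto simp: nat_span_iff if_distrib if_distribR sum.delta
        intro!: exI[of _ "\<lambda>b. if b = g then m else 0"] cong: if_cong)
  then show ?thesis
    using assms by (intro nat_span_add)
qed

lemma zero_in_saturation: "finite B \<Longrightarrow> B \<subseteq> carrier_vec k \<Longrightarrow> 0\<^sub>v k \<in> saturation k B"
  by (auto simp: saturation_iff intro!: exI[of _ "\<lambda>_. 0"])

section \<open>Finitely many remainders modulo the monoid\<close>

lemma finite_bounded_int_vec: "finite {x \<in> carrier_vec k. \<forall>i<k. \<bar>x $ i\<bar> \<le> (M i :: int)}"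
proof (rule finite_subset)
  show "{x \<in> carrier_vec k. \<forall>i<k. \<bar>x $ i\<bar> \<le> M i} \<subseteq> vec k ` (\<Pi>\<^sub>E i\<in>{..<k}. {- M i..M i})"
  proof safe
    fix x :: "int vec"
    assume x: "x \<in> carrier_vec k" "\<forall>i<k. \<bar>x $ i\<bar> \<le> M i"
    then have "x = vec k (restrict (($) x) {..<k})"
      by auto
    moreover have "restrict (($) x) {..<k} \<in> (\<Pi>\<^sub>E i\<in>{..<k}. {- M i..M i})"
      using x by (auto simp: abs_le_iff)
    ultimately show "x \<in> vec k ` (\<Pi>\<^sub>E i\<in>{..<k}. {- M i..M i})"
      by blast
  qed
qed (auto intro!: finite_PiE)

text \<open>After the integer parts of the coefficients are split off, the remainder has
  coefficients in [0, 1). It is therefore an integer vector in a box that depends on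
  \<open>B\<close> alone, and such a box has only finitely many.\<close>

lemma saturation_finite_over_nat_span:
  assumes "finite B" "B \<subseteq> carrier_vec k"
  obtains F where "finite F" "F \<subseteq> saturation k B"
    "\<And>x. x \<in> saturation k B \<Longrightarrow> \<exists>f\<in>F. \<exists>y\<in>nat_span k B. x = f + y"
proof
  let ?M = "\<lambda>i. \<Sum>b\<in>B. \<bar>b $ i\<bar>"
  \<comment> \<open>All points of the saturation in that box are taken, whether or not they occur as
    remainders. Intersecting with the saturation makes the second claim immediate.\<close>
  let ?F = "{x \<in> carrier_vec k. \<forall>i<k. \<bar>x $ i\<bar> \<le> ?M i} \<inter> saturation k B"
  show "finite ?F"
    using finite_bounded_int_vec[of k ?M] by simp
  show "?F \<subseteq> saturation k B"
    by blast
  fix x assume "x \<in> saturation k B"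
  then obtain c where x: "x \<in> carrier_vec k" and c: "\<forall>b\<in>B. c b \<ge> 0"
    and xc: "\<forall>i<k. real_of_int (x $ i) = (\<Sum>b\<in>B. c b * real_of_int (b $ i))"
    using assms by (auto simp: saturation_iff)
  \<comment> \<open>As \<open>c b\<close> is nonnegative on \<open>B\<close>, \<open>nat\<close>
    changes nothing here, and \<open>x - y\<close> has the coefficients
    \<open>frac (c b)\<close>.\<close>
  define y where "y = vec k (\<lambda>i. \<Sum>b\<in>B. int (nat \<lfloor>c b\<rfloor>) * b $ i)"
  have y: "y \<in> nat_span k B" "y \<in> carrier_vec k"
    using assms by (auto simp: y_def nat_span_iff intro!: exI[of _ "\<lambda>b. nat \<lfloor>c b\<rfloor>"])
  have f: "real_of_int ((x - y) $ i) = (\<Sum>b\<in>B. frac (c b) * real_of_int (b $ i))" if "i < k" for i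
  proof -
    have "real_of_int (y $ i) = (\<Sum>b\<in>B. of_int \<lfloor>c b\<rfloor> * real_of_int (b $ i))"
      using that c by (auto simp: y_def intro!: sum.cong)
    then show ?thesis
      using that xc x y by (simp add: frac_def left_diff_distrib sum_subtractf)
  qed
  have "x - y \<in> saturation k B"
    using assms x y f by (auto simp: saturation_iff intro!: exI[of _ "\<lambda>b. frac (c b)"])
  moreover have "\<bar>(x - y) $ i\<bar> \<le> ?M i" if "i < k" for i
  proof -
    have "\<bar>\<Sum>b\<in>B. frac (c b) * real_of_int (b $ i)\<bar> \<le> (\<Sum>b\<in>B. \<bar>real_of_int (b $ i)\<bar>)"
    proof (rule order_trans[OF sum_abs], rule sum_mono)
      fix b
      have "frac (c b) \<le> 1"
        using frac_lt_1[of "c b"] by simp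
      then show "\<bar>frac (c b) * real_of_int (b $ i)\<bar> \<le> \<bar>real_of_int (b $ i)\<bar>"
        by (simp add: abs_mult mult_left_le_one_le)
    qed
    then have "real_of_int \<bar>(x - y) $ i\<bar> \<le> real_of_int (?M i)"
      using f[OF that] by (simp del: index_minus_vec)
    then show ?thesis
      by linarith
  qed
  moreover have "x = (x - y) + y"
    using x y by auto
  ultimately show "\<exists>f\<in>?F. \<exists>y\<in>nat_span k B. x = f + y"
    using x y by (intro bexI[of _ "x - y"] bexI[of _ y]) auto
qed

section \<open>Passing between the original points and the lifted ones\<close>

lemma snoc_vec_carrier [simp]: "snoc_vec v z \<in> carrier_vec (Suc d) \<longleftrightarrow> v \<in> carrier_vec d"
  unfolding snoc_vec_def carrier_dim_vec by simp

lemma index_snoc_vec: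
  "v \<in> carrier_vec d \<Longrightarrow> i < d + 1 \<Longrightarrow> snoc_vec v z $ i = (if i < d then v $ i else z)"
  by (auto simp: snoc_vec_def)

lemma lifted_set_carrier:
  assumes "\<And>i. i \<in> {1..n} \<Longrightarrow> p i \<in> carrier_vec d"
  shows "lifted_set d n p w \<subseteq> carrier_vec (d + 1)"
  using assms by (auto simp: lifted_set_def)

lemma finite_lifted_set: "finite (lifted_set d n p w)"
proof -
  have "lifted_set d n p w = (\<lambda>i. snoc_vec (p i) (int (w i))) ` {1..n} \<union> {snoc_vec (0\<^sub>v d) 1}"
    by (auto simp: lifted_set_def)
  then show ?thesis
    by simp
qed

text \<open>Each point used in a combination for \<open>v\<close> is replaced by a lift of it, and
  \<open>N\<close> is the weight that accumulates in the last coordinate. Since \<open>p\<close> may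
  take the same value at several indices, a point can have several lifts; \<open>h\<close> selects
  one index, hence one weight, for each point.\<close>

lemma nat_span_lift:
  assumes p: "\<And>i. i \<in> {1..n} \<Longrightarrow> p i \<in> carrier_vec d"
    and "v \<in> nat_span d (p ` {1..n})"
  obtains N where "snoc_vec v (int N) \<in> nat_span (d + 1) (lifted_set d n p w)"
proof -
  let ?A = "p ` {1..n}" and ?B = "lifted_set d n p w"
  have A: "finite ?A" "?A \<subseteq> carrier_vec d"
    using p by auto
  have B: "finite ?B" "?B \<subseteq> carrier_vec (d + 1)"
    by (rule finite_lifted_set, rule lifted_set_carrier, rule p)
  obtain c where v: "v \<in> carrier_vec d" and c: "\<forall>i<d. v $ i = (\<Sum>u\<in>?A. int (c u) * u $ i)"
    using assms(2) A by (auto simp: nat_span_iff)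
  define h where "h = inv_into {1..n} p"
  have h: "h u \<in> {1..n}" "p (h u) = u" if "u \<in> ?A" for u
    using that unfolding h_def by (rule inv_into_into, rule f_inv_into_f)
  define g where "g u = snoc_vec u (int (w (h u)))" for u
  have gB: "g ` ?A \<subseteq> ?B"
  proof (rule image_subsetI)
    fix u assume "u \<in> ?A"
    then show "g u \<in> ?B"
      unfolding g_def lifted_set_def using h[of u] by (intro UnI1 CollectI exI[of _ "h u"]) simp
  qed
  have index: "g u $ i = (if i < d then u $ i else int (w (h u)))"
    if "u \<in> ?A" "i < d + 1" for u i
    using that A unfolding g_def by (intro index_snoc_vec) auto
  \<comment> \<open>The first \<open>d\<close> coordinates of \<open>g u\<close> recover
    \<open>u\<close>, so coefficients on \<open>?A\<close> can be carried to the selected lifts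
    without collisions.\<close>
  have inj: "inj_on g ?A"
  proof (rule inj_onI)
    fix u u' assume u: "u \<in> ?A" "u' \<in> ?A" "g u = g u'"
    then have "u $ i = u' $ i" if "i < d" for i
      using index[of u i] index[of u' i] that by simp
    moreover have "u \<in> carrier_vec d" "u' \<in> carrier_vec d"
      using u A by blast+
    ultimately show "u = u'"
      by (intro eq_vecI) auto
  qed
  \<comment> \<open>Lifts that were not selected get coefficient 0. The generator
    \<open>(0, 1)\<close> gets 0 as well, unless it happens to be the selected lift of the zero
    vector.\<close>
  define e where "e b = (if b \<in> g ` ?A then c (inv_into ?A g b) else 0)" for b
  define N where "N = (\<Sum>u\<in>?A. c u * w (h u))"
  have "snoc_vec v (int N) $ i = (\<Sum>b\<in>?B. int (e b) * b $ i)" if "i < d + 1" for i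
  proof -
    have "(\<Sum>b\<in>?B. int (e b) * b $ i) = (\<Sum>b\<in>g ` ?A. int (e b) * b $ i)"
      using B gB by (intro sum.mono_neutral_right) (auto simp: e_def)
    also have "\<dots> = (\<Sum>u\<in>?A. int (e (g u)) * g u $ i)"
      using inj by (simp add: sum.reindex)
    also have "\<dots> = (\<Sum>u\<in>?A. int (c u) * (if i < d then u $ i else int (w (h u))))"
      using that inj by (intro sum.cong) (auto simp: e_def index)
    also have "\<dots> = snoc_vec v (int N) $ i"
      using v c that by (auto simp: index_snoc_vec N_def)
    finally show ?thesis ..
  qed
  then have "snoc_vec v (int N) \<in> nat_span (d + 1) ?B"
    using B v by (auto simp: nat_span_iff)
  then show thesis
    by (rule that)
qed

text \<open>Dropping the last coordinate sends a cone combination of lifts to one of the original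
  points, as \<open>(0, 1)\<close> is sent to 0. Several lifts may lie over one point, so their
  coefficients are added up along each fibre of the projection.\<close>

lemma saturation_project:
  assumes p: "\<And>i. i \<in> {1..n} \<Longrightarrow> p i \<in> carrier_vec d"
    and "x \<in> saturation (d + 1) (lifted_set d n p w)"
  shows "vec_first x d \<in> saturation d (p ` {1..n})"
proof -
  let ?A = "p ` {1..n}" and ?B = "lifted_set d n p w"
  let ?pi = "\<lambda>b :: int vec. vec_first b d"
  \<comment> \<open>The lift of every \<open>p i\<close> lies in \<open>?S\<close>, so the only
    generator that can be missing is \<open>(0, 1)\<close>, which contributes 0 after projection. If
    0 is in \<open>?A\<close>, then \<open>(0, 1)\<close> belongs to \<open>?S\<close> too and is
    counted in the fibre over 0.\<close>
  let ?S = "{b \<in> ?B. ?pi b \<in> ?A}"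
  have A: "finite ?A" "?A \<subseteq> carrier_vec d"
    using p by auto
  have B: "finite ?B" "?B \<subseteq> carrier_vec (d + 1)"
    by (rule finite_lifted_set, rule lifted_set_carrier, rule p)
  have pi_snoc: "?pi (snoc_vec v z) = v" if "v \<in> carrier_vec d" for v z
    using that index_snoc_vec[of v d _ z] by (intro eq_vecI) (auto simp: vec_first_def)
  have pi_B: "?pi b = 0\<^sub>v d" if b: "b \<in> ?B - ?S" for b
  proof -
    have "b = snoc_vec (0\<^sub>v d) 1 \<or> (\<exists>i\<in>{1..n}. b = snoc_vec (p i) (int (w i)))"
      using b unfolding lifted_set_def by auto
    moreover have False if "i \<in> {1..n}" "b = snoc_vec (p i) (int (w i))" for i
      using b that pi_snoc[OF p] by auto
    ultimately show ?thesis
      using pi_snoc[OF zero_carrier_vec] by blast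
  qed
  obtain c where c: "\<forall>b\<in>?B. c b \<ge> 0"
    and xc: "\<forall>i<d + 1. real_of_int (x $ i) = (\<Sum>b\<in>?B. c b * real_of_int (b $ i))"
    using assms(2) B by (auto simp: saturation_iff)
  define e where "e u = (\<Sum>b\<in>{b \<in> ?S. ?pi b = u}. c b)" for u
  have "real_of_int (?pi x $ i) = (\<Sum>u\<in>?A. e u * real_of_int (u $ i))" if "i < d" for i
  proof -
    have first: "?pi b $ i = b $ i" for b
      using that by (simp add: vec_first_def)
    have "real_of_int (?pi x $ i) = (\<Sum>b\<in>?B. c b * real_of_int (?pi b $ i))"
      using xc that by (simp add: first)
    also have "\<dots> = (\<Sum>b\<in>?S. c b * real_of_int (?pi b $ i))"
    proof (intro sum.mono_neutral_right ballI)
      fix b assume "b \<in> ?B - ?S"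
      with pi_B[OF this] show "c b * real_of_int (?pi b $ i) = 0"
        using that by simp
    qed (use B in auto)
    also have "\<dots> = (\<Sum>u\<in>?A. \<Sum>b\<in>{b \<in> ?S. ?pi b = u}. c b * real_of_int (?pi b $ i))"
      using A B by (intro sum.group[symmetric]) auto
    also have "\<dots> = (\<Sum>u\<in>?A. e u * real_of_int (u $ i))"
      by (auto simp: e_def sum_distrib_right intro!: sum.cong)
    finally show ?thesis .
  qed
  moreover have "e u \<ge> 0" for u
    using c by (auto simp: e_def intro!: sum_nonneg)
  ultimately show ?thesis
    using A by (auto simp: saturation_iff intro!: exI[of _ e])
qed

section \<open>Choosing the last coordinate \<open>\<delta>\<close>\<close>

theorem theorem2p3:
  fixes d n :: nat
    and p :: "nat \<Rightarrow> int vec"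
    and w :: "nat \<Rightarrow> nat"
    and A :: "int vec set"
    and a :: "int vec"
  assumes "\<And>i. i \<in> {1..n} \<Longrightarrow> p i \<in> carrier_vec d"
    and "A = {p i | i. i \<in> {1..n}}"
    and "a \<in> nat_span d A"
    and "{a + x | x. x \<in> saturation d A} \<subseteq> nat_span d A"
  shows "\<exists>\<delta> :: nat.
           snoc_vec a (int \<delta>) \<in> nat_span (d + 1) (lifted_set d n p w) \<and>
           {snoc_vec a (int \<delta>) + x | x. x \<in> saturation (d + 1) (lifted_set d n p w)}
             \<subseteq> nat_span (d + 1) (lifted_set d n p w)"
proof -
  let ?B = "lifted_set d n p w"
  have A_eq: "A = p ` {1..n}"
    using assms(2) by auto
  have a: "a \<in> carrier_vec d"
    using assms(1,3) by (subst (asm) nat_span_iff) (auto simp: A_eq)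
  have B: "finite ?B" "?B \<subseteq> carrier_vec (d + 1)"
    by (rule finite_lifted_set, rule lifted_set_carrier, rule assms(1))
  have gen: "snoc_vec (0\<^sub>v d) 1 \<in> ?B"
    by (simp add: lifted_set_def)
  \<comment> \<open>The bound is claimed for all \<open>\<delta>\<close> from \<open>D\<close> on,
    and not for a single value, so that the thresholds of finitely many \<open>f\<close> can be met
    at once.\<close>
  have threshold: "\<exists>D. \<forall>\<delta>\<ge>D. snoc_vec a (int \<delta>) + f \<in> nat_span (d + 1) ?B"
    if f: "f \<in> saturation (d + 1) ?B" for f
  proof -
    have fc: "f \<in> carrier_vec (d + 1)"
      using f by (simp add: saturation_def)
    have "a + vec_first f d \<in> nat_span d (p ` {1..n})"
      using saturation_project[OF assms(1) f] assms(4) by (auto simp: A_eq)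
    then obtain N where N: "snoc_vec (a + vec_first f d) (int N) \<in> nat_span (d + 1) ?B"
      using nat_span_lift[of n p d "a + vec_first f d"] assms(1) by metis
    \<comment> \<open>Index \<open>d\<close> is the last coordinate. The sum has height
      \<open>\<delta> + f $ d\<close> there and the lift found above has height \<open>N\<close>.
      The bound on \<open>\<delta>\<close> makes the difference \<open>m\<close> nonnegative, so
      \<open>m\<close> copies of \<open>(0, 1)\<close> fill the gap; \<open>f $ d\<close> itself may
      be negative when points outside the original data are not excluded by sign, and the bound uses
      no sign for it.\<close>
    have "snoc_vec a (int \<delta>) + f \<in> nat_span (d + 1) ?B" if \<delta>: "\<delta> \<ge> nat (int N - f $ d)" for \<delta>
    proof -
      define m where "m = nat (int \<delta> + f $ d - int N)"
      have m: "int m = int \<delta> + f $ d - int N"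
        using \<delta> by (simp add: m_def)
      have "snoc_vec a (int \<delta>) + f =
          snoc_vec (a + vec_first f d) (int N) + int m \<cdot>\<^sub>v snoc_vec (0\<^sub>v d) 1" (is "?l = ?r")
      proof (rule eq_vecI)
        have dims: "dim_vec (snoc_vec u z) = d + 1" if "u \<in> carrier_vec d" for u and z :: int
          using that by (intro carrier_vecD) simp
        have au: "a + vec_first f d \<in> carrier_vec d"
          using a by simp
        show "dim_vec ?l = dim_vec ?r"
          using fc by (simp add: dims)
        fix i assume "i < dim_vec ?r"
        then have i: "i < d + 1"
          by (simp add: dims)
        moreover have "vec_first f d $ i = f $ i" if "i < d"
          using that by (simp add: vec_first_def)
        ultimately show "?l $ i = ?r $ i"
          using fc m a
          by (auto simp: dims less_Suc_eq index_snoc_vec[OF a] index_snoc_vec[OF au]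
              index_snoc_vec[OF zero_carrier_vec])
      qed
      then show ?thesis
        using nat_span_add_multiple[OF B N gen] by simp
    qed
    then show ?thesis
      by blast
  qed
  obtain F where F: "finite F" "F \<subseteq> saturation (d + 1) ?B"
    "\<And>x. x \<in> saturation (d + 1) ?B \<Longrightarrow> \<exists>f\<in>F. \<exists>y\<in>nat_span (d + 1) ?B. x = f + y"
    using saturation_finite_over_nat_span[OF B] by metis
  \<comment> \<open>The zero vector is added so that the same choice of \<open>\<delta>\<close> also
    puts \<open>(a, \<delta>)\<close> itself into the monoid.\<close>
  let ?F = "insert (0\<^sub>v (d + 1)) F"
  have "\<forall>f\<in>?F. \<exists>D. \<forall>\<delta>\<ge>D. snoc_vec a (int \<delta>) + f \<in> nat_span (d + 1) ?B"
    using threshold F(2) zero_in_saturation[OF B] by blast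
  then obtain D where D: "\<And>f \<delta>. f \<in> ?F \<Longrightarrow> \<delta> \<ge> D f \<Longrightarrow>
      snoc_vec a (int \<delta>) + f \<in> nat_span (d + 1) ?B"
    by metis
  \<comment> \<open>Each threshold persists for larger values, so the maximum serves every element
    of the finite set \<open>?F\<close>.\<close>
  define \<delta> where "\<delta> = Max (D ` ?F)"
  have \<delta>: "snoc_vec a (int \<delta>) + f \<in> nat_span (d + 1) ?B" if "f \<in> ?F" for f
    using that F(1) D[OF that] unfolding \<delta>_def by (meson Max_ge finite_imageI finite_insert imageI)
  have ac: "snoc_vec a (int \<delta>) \<in> carrier_vec (d + 1)"
    using a by simp
  show ?thesis
  proof (intro exI conjI subsetI)
    show "snoc_vec a (int \<delta>) \<in> nat_span (d + 1) ?B"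
      using \<delta>[of "0\<^sub>v (d + 1)"] right_zero_vec[OF ac] by simp
    fix z assume "z \<in> {snoc_vec a (int \<delta>) + x | x. x \<in> saturation (d + 1) ?B}"
    then obtain x where x: "x \<in> saturation (d + 1) ?B" "z = snoc_vec a (int \<delta>) + x"
      by blast
    from F(3)[OF x(1)] obtain f y where fy: "f \<in> F" "y \<in> nat_span (d + 1) ?B" "x = f + y"
      by blast
    have "f \<in> carrier_vec (d + 1)" "y \<in> carrier_vec (d + 1)"
      using fy F(2) nat_span_iff[OF B] by (auto simp: saturation_def)
    \<comment> \<open>The bracketed sum is in the monoid by the choice of \<open>\<delta>\<close>,
      and adding \<open>y\<close> stays inside.\<close>
    then have "z = (snoc_vec a (int \<delta>) + f) + y"
      using x fy assoc_add_vec[OF ac] by metis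
    then show "z \<in> nat_span (d + 1) ?B"
      using nat_span_add[OF B \<delta> fy(2)] fy(1) by simp
  qed
qed

end
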